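(* Let $f$ be a real-valued function of class $C^3$ in a neighborhood of a point $\alpha\in\mathbb{R}$ with $f(\alpha)=0$ and $f'(\alpha)\neq0$. Put $u(x):=1+f(x)$ and, for $x$ with $u(x)>0$, define $$g_p(x):=\frac{u(x)^p-1}{p}\quad(p\in\mathbb{R},\ p\ne0),\qquad g_0(x):=\ln u(x).$$ Then for every $p\in\mathbb{R}$ one has $g_p(x)=0\iff f(x)=0$; moreover $g_1=f$, and $g_p\to\ln u$ as $p\to0$. For every $p\in\mathbb{R}$, $$g_p'(\alpha)=f'(\alpha),\qquad g_p''(\alpha)=(p-1)f'(\alpha)^2+f''(\alpha),$$ and the Newton map $N_p(x):=x-g_p(x)/g_p'(x)$ of $g_p$ satisfies $N_p''(\alpha)=g_p''(\alpha)/g_p'(\alpha)$. Consequently, for $$p^\ast:=1-\frac{f''(\alpha)}{f'(\alpha)^2}$$ one has $N_{p^\ast}''(\alpha)=0$, and Newton's method applied to $g_{p^\ast}$ converges locally to $\alpha$ with order at least three.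
   Context: Order at least three means: there are constants $C,r>0$ such that for every starting point $x_0$ with $|x_0-\alpha|<r$ the Newton iterates $x_{k+1}=N_{p^\ast}(x_k)$ are well defined, converge to $\alpha$, and satisfy $|x_{k+1}-\alpha|\le C|x_k-\alpha|^3$. *)

theory Defs
  imports "HOL-Analysis.Analysis"
begin

(* Intended for open S only: differentiability is two-sided, in the full type real. *)
primrec Ck_on :: "nat \<Rightarrow> (real \<Rightarrow> real) \<Rightarrow> real set \<Rightarrow> bool" where
  "Ck_on 0 f S \<longleftrightarrow> continuous_on S f"
| "Ck_on (Suc k) f S \<longleftrightarrow> (\<forall>x\<in>S. f differentiable (at x)) \<and> Ck_on k (deriv f) S"

(* deriv is a total operator, so an equation about (deriv ^^ 2) h a carries content
   only together with this existence statement. *)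
definition twice_differentiable_at :: "(real \<Rightarrow> real) \<Rightarrow> real \<Rightarrow> bool" where
  "twice_differentiable_at h a \<longleftrightarrow>
     (\<forall>\<^sub>F x in nhds a. h differentiable (at x)) \<and> deriv h differentiable (at a)"

definition u :: "(real \<Rightarrow> real) \<Rightarrow> real \<Rightarrow> real" where
  "u f x = 1 + f x"

(* Meaningful only where u f x > 0. *)
definition g :: "(real \<Rightarrow> real) \<Rightarrow> real \<Rightarrow> real \<Rightarrow> real" where
  "g f p x = (if p = 0 then ln (u f x) else (u f x powr p - 1) / p)"

definition newton_map :: "(real \<Rightarrow> real) \<Rightarrow> real \<Rightarrow> real" where
  "newton_map h x = x - h x / deriv h x"

(* The points at which a Newton step for a function h with domain S is well defined. *)
definition newton_domain :: "real set \<Rightarrow> (real \<Rightarrow> real) \<Rightarrow> real set" where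
  "newton_domain S h = {x \<in> S. h differentiable (at x) \<and> deriv h x \<noteq> 0}"

definition newton_order_at_least_three :: "real set \<Rightarrow> (real \<Rightarrow> real) \<Rightarrow> real \<Rightarrow> bool" where
  "newton_order_at_least_three S h a \<longleftrightarrow>
     (\<exists>C>0. \<exists>r>0. \<forall>x0. \<bar>x0 - a\<bar> < r \<longrightarrow>
        (let x = (\<lambda>k. (newton_map h ^^ k) x0) in
           (\<forall>k. x k \<in> newton_domain S h) \<and>
           x \<longlonglongrightarrow> a \<and>
           (\<forall>k. \<bar>x (Suc k) - a\<bar> \<le> C * \<bar>x k - a\<bar> ^ 3)))"

definition p_star :: "(real \<Rightarrow> real) \<Rightarrow> real \<Rightarrow> real" where
  "p_star f a = 1 - (deriv ^^ 2) f a / (deriv f a)\<^sup>2"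

end

theory Submission
  imports Defs
begin

text \<open>
  On the open set where \<open>u > 0\<close> one has \<open>g\<^sub>p' = u\<^sup>p\<^sup>-\<^sup>1 f'\<close> for every \<open>p\<close>, the case \<open>p = 0\<close> included, so all
  derivatives of \<open>g\<^sub>p\<close> at the zero \<open>\<alpha>\<close>, where \<open>u = 1\<close>, are explicit.

  The rest concerns an arbitrary function \<open>h\<close> with a simple zero at \<open>\<alpha>\<close>, and rests on the identity
  \<open>N' = h h'' / h'\<^sup>2\<close> for its Newton map \<open>N\<close>. Differentiating at \<open>\<alpha>\<close> gives
  \<open>N''(\<alpha>) = h''(\<alpha>) / h'(\<alpha>)\<close>. If \<open>h''(\<alpha>) = 0\<close>, then \<open>h\<close> and \<open>h''\<close> both vanish at \<open>\<alpha>\<close>, hence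
  \<open>N'(x) = O((x - \<alpha>)\<^sup>2)\<close>, and the mean value inequality yields
  \<open>\<bar>N(x) - \<alpha>\<bar> \<le> C \<bar>x - \<alpha>\<bar>\<^sup>3\<close> (lemma \<open>newton_cubic\<close>). Close to \<open>\<alpha>\<close> this is at most
  \<open>\<bar>x - \<alpha>\<bar> / 2\<close>, so the iterates stay there and converge. The parameter
  \<open>p\<^sup>*\<close> is the one for which \<open>g\<^sub>p''(\<alpha>) = 0\<close>.
\<close>

section \<open>Second derivatives\<close>

lemma twice_differentiable_atI:
  assumes "open V" "a \<in> V"
    and "\<And>x. x \<in> V \<Longrightarrow> (h has_real_derivative h1 x) (at x)"
    and "(h1 has_real_derivative D) (at a)"
  shows "twice_differentiable_at h a" and "(deriv ^^ 2) h a = D"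
proof -
  have "(deriv h has_real_derivative D) (at a)"
    by (rule has_field_derivative_transform_within_open[OF assms(4,1,2)])
       (metis DERIV_imp_deriv assms(3))
  moreover have "\<forall>\<^sub>F x in nhds a. h differentiable (at x)"
    using eventually_nhds_in_open[OF assms(1,2)]
    by eventually_elim (use assms(3) in \<open>auto simp: real_differentiable_def\<close>)
  ultimately show "twice_differentiable_at h a" "(deriv ^^ 2) h a = D"
    unfolding twice_differentiable_at_def
    by (simp_all only: real_differentiable_def numeral_2_eq_2 funpow.simps o_apply id_apply
        DERIV_imp_deriv) blast+
qed

section \<open>Newton's method at a simple zero\<close>

text \<open>A function \<open>h\<close> with a simple zero \<open>a\<close> whose second derivative exists around \<open>a\<close> and is
  differentiable at \<open>a\<close>. The first two derivatives are the parameters \<open>h1\<close> and \<open>h2\<close>, so that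
  they can be given by explicit formulas on \<open>V\<close>.\<close>

locale simple_zero =
  fixes V :: "real set" and h h1 h2 :: "real \<Rightarrow> real" and a :: real
  assumes open_V: "open V" and a_in_V: "a \<in> V"
    and h1: "\<And>x. x \<in> V \<Longrightarrow> (h has_real_derivative h1 x) (at x)"
    and h2: "\<And>x. x \<in> V \<Longrightarrow> (h1 has_real_derivative h2 x) (at x)"
    and h2_differentiable: "h2 differentiable (at a)"
    and zero: "h a = 0" and simple: "h1 a \<noteq> 0"
begin

lemma h3: "(h2 has_real_derivative deriv h2 a) (at a)"
  using h2_differentiable by (simp add: DERIV_deriv_iff_real_differentiable)

lemma newton_domain_eq: "newton_domain V h = {x \<in> V. h1 x \<noteq> 0}"
  unfolding newton_domain_def using h1 DERIV_imp_deriv real_differentiable_def by fastforce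

lemma open_newton_domain: "open (newton_domain V h)"
proof -
  have "continuous_on V h1"
    using h2 by (meson DERIV_continuous continuous_at_imp_continuous_on)
  then have "open (V \<inter> h1 -` (- {0}))"
    using open_V by (intro continuous_open_preimage) auto
  also have "V \<inter> h1 -` (- {0}) = newton_domain V h"
    unfolding newton_domain_eq by auto
  finally show ?thesis .
qed

lemma a_in_newton_domain: "a \<in> newton_domain V h"
  unfolding newton_domain_eq using a_in_V simple by auto

lemma newton_map_eq: "x \<in> V \<Longrightarrow> newton_map h x = x - h x / h1 x"
  unfolding newton_map_def using h1 DERIV_imp_deriv by metis

lemma newton_map_deriv:
  assumes "x \<in> newton_domain V h"
  shows "(newton_map h has_real_derivative h x * h2 x / (h1 x)\<^sup>2) (at x)"
proof -
  have x: "x \<in> V" "h1 x \<noteq> 0" using assms newton_domain_eq by auto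
  have "((\<lambda>x. x - h x / h1 x) has_real_derivative h x * h2 x / (h1 x)\<^sup>2) (at x)"
    by (rule DERIV_cong[OF DERIV_diff[OF DERIV_ident DERIV_divide[OF h1[OF x(1)] h2[OF x(1)] x(2)]]])
       (use x in \<open>simp add: field_simps power2_eq_square\<close>)
  then show ?thesis
    by (rule has_field_derivative_transform_within_open[OF _ open_V x(1)])
       (simp add: newton_map_eq)
qed

lemma newton_map_second_deriv:
  shows "twice_differentiable_at (newton_map h) a"
    and "(deriv ^^ 2) (newton_map h) a = h2 a / h1 a"
proof -
  have "((\<lambda>x. h x * h2 x / (h1 x)\<^sup>2) has_real_derivative h2 a / h1 a) (at a)"
    by (rule DERIV_cong[OF DERIV_divide[OF DERIV_mult[OF h1[OF a_in_V] h3]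
          DERIV_power[OF h2[OF a_in_V], of 2]]])
       (use zero simple in \<open>auto simp: field_simps power2_eq_square\<close>)
  note * = twice_differentiable_atI[OF open_newton_domain a_in_newton_domain newton_map_deriv this]
  show "twice_differentiable_at (newton_map h) a"
    and "(deriv ^^ 2) (newton_map h) a = h2 a / h1 a" using * by auto
qed

text \<open>Here \<open>h\<close> and \<open>h2\<close> both vanish at \<open>a\<close>, so dividing each by \<open>x - a\<close> leaves difference quotients
  and \<open>N'(x) / (x - a)\<^sup>2\<close> has a finite limit at \<open>a\<close>.\<close>

lemma newton_map_deriv_quadratic:
  assumes "h2 a = 0"
  obtains C where "C > 0" "\<forall>\<^sub>F x in nhds a. \<bar>h x * h2 x / (h1 x)\<^sup>2\<bar> \<le> C * \<bar>x - a\<bar>\<^sup>2"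
proof -
  have "((\<lambda>x. (h x / (x - a)) * (h2 x / (x - a)) / (h1 x)\<^sup>2)
          \<longlongrightarrow> h1 a * deriv h2 a / (h1 a)\<^sup>2) (at a)" (is "(?q \<longlongrightarrow> ?L) _")
    using h1[OF a_in_V] h3 DERIV_isCont[OF h2[OF a_in_V]] zero assms simple
    by (intro tendsto_intros) (auto simp: has_field_derivative_iff isCont_def)
  then have "\<forall>\<^sub>F x in at a. \<bar>?q x\<bar> < \<bar>?L\<bar> + 1"
    by (intro order_tendstoD(2)[OF tendsto_rabs]) auto
  then have "\<forall>\<^sub>F x in nhds a. x \<noteq> a \<longrightarrow> \<bar>?q x\<bar> < \<bar>?L\<bar> + 1"
    by (simp add: eventually_at_filter)
  then have "\<forall>\<^sub>F x in nhds a. \<bar>h x * h2 x / (h1 x)\<^sup>2\<bar> \<le> (\<bar>?L\<bar> + 1) * \<bar>x - a\<bar>\<^sup>2"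
  proof eventually_elim
    case (elim x)
    show ?case
    proof (cases "x = a")
      case True
      then show ?thesis using zero by simp
    next
      case False
      have "h x * h2 x / (h1 x)\<^sup>2 = ?q x * (x - a)\<^sup>2"
        using False by (simp add: power2_eq_square)
      then have "\<bar>h x * h2 x / (h1 x)\<^sup>2\<bar> = \<bar>?q x\<bar> * \<bar>x - a\<bar>\<^sup>2"
        by (simp only: abs_mult power_abs)
      also have "\<dots> \<le> (\<bar>?L\<bar> + 1) * \<bar>x - a\<bar>\<^sup>2"
        using elim False by (intro mult_right_mono) auto
      finally show ?thesis .
    qed
  qed
  moreover have "\<bar>?L\<bar> + 1 > 0" by (intro add_nonneg_pos) simp_all
  ultimately show ?thesis using that by blast
qed

lemma newton_cubic:
  assumes "h2 a = 0"
  obtains C r where "C > 0" "r > 0" "ball a r \<subseteq> newton_domain V h"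
    "\<And>x. x \<in> ball a r \<Longrightarrow> \<bar>newton_map h x - a\<bar> \<le> C * \<bar>x - a\<bar> ^ 3"
proof -
  obtain C where C: "C > 0" "\<forall>\<^sub>F x in nhds a. \<bar>h x * h2 x / (h1 x)\<^sup>2\<bar> \<le> C * \<bar>x - a\<bar>\<^sup>2"
    using newton_map_deriv_quadratic[OF assms] .
  have "\<forall>\<^sub>F x in nhds a. x \<in> newton_domain V h"
    using open_newton_domain a_in_newton_domain by (rule eventually_nhds_in_open)
  from eventually_conj[OF this C(2)] obtain r where r: "r > 0"
    "\<And>x. dist x a < r \<Longrightarrow> x \<in> newton_domain V h \<and> \<bar>h x * h2 x / (h1 x)\<^sup>2\<bar> \<le> C * \<bar>x - a\<bar>\<^sup>2"
    by (auto simp: eventually_nhds_metric)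
  have "\<bar>newton_map h x - a\<bar> \<le> C * \<bar>x - a\<bar> ^ 3" if x: "x \<in> ball a r" for x
  proof -
    define S where "S = cball a \<bar>x - a\<bar>"
    have S: "dist z a < r" "\<bar>z - a\<bar> \<le> \<bar>x - a\<bar>" if "z \<in> S" for z
      using that x by (auto simp: S_def dist_real_def)
    have "norm (newton_map h x - newton_map h a) \<le> C * \<bar>x - a\<bar>\<^sup>2 * norm (x - a)"
    proof (rule field_differentiable_bound[where S = S and f' = "\<lambda>z. h z * h2 z / (h1 z)\<^sup>2"])
      show "(newton_map h has_field_derivative h z * h2 z / (h1 z)\<^sup>2) (at z within S)"
        if "z \<in> S" for z
        using newton_map_deriv r(2) S(1)[OF that] has_field_derivative_at_within by blast
      show "norm (h z * h2 z / (h1 z)\<^sup>2) \<le> C * \<bar>x - a\<bar>\<^sup>2" if "z \<in> S" for z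
      proof -
        have "\<bar>z - a\<bar>\<^sup>2 \<le> \<bar>x - a\<bar>\<^sup>2" using S(2)[OF that] by (intro power_mono) auto
        then have "C * \<bar>z - a\<bar>\<^sup>2 \<le> C * \<bar>x - a\<bar>\<^sup>2" using C(1) by (intro mult_left_mono) auto
        then show ?thesis using r(2)[OF S(1)[OF that]] by (simp only: real_norm_def) linarith
      qed
    qed (auto simp: S_def dist_real_def)
    moreover have "newton_map h a = a" by (simp add: newton_map_def zero)
    ultimately show ?thesis by (simp add: power2_eq_square power3_eq_cube mult.assoc)
  qed
  moreover have "ball a r \<subseteq> newton_domain V h"
    using r(2) by (auto simp: dist_commute)
  ultimately show ?thesis using that C(1) r(1) by blast
qed

lemma newton_order_three:
  assumes "h2 a = 0"
  shows "newton_order_at_least_three V h a"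
proof -
  obtain C r0 where C: "C > 0" "r0 > 0" "ball a r0 \<subseteq> newton_domain V h"
    "\<And>x. x \<in> ball a r0 \<Longrightarrow> \<bar>newton_map h x - a\<bar> \<le> C * \<bar>x - a\<bar> ^ 3"
    using newton_cubic[OF assms] by blast
  \<comment> \<open>The radius is chosen with \<open>C r\<^sup>2 \<le> 1/2\<close>, so that a Newton step halves the error.\<close>
  define r where "r = min r0 (sqrt (1 / (2 * C)))"
  have r: "r > 0" "r \<le> r0" using C by (auto simp: r_def)
  have "r\<^sup>2 \<le> (sqrt (1 / (2 * C)))\<^sup>2"
    using r(1) by (intro power_mono) (auto simp: r_def)
  then have Cr: "C * r\<^sup>2 \<le> 1 / 2" using C(1) by (simp add: field_simps)
  have half: "\<bar>newton_map h x - a\<bar> \<le> \<bar>x - a\<bar> / 2" if "\<bar>x - a\<bar> < r" for x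
  proof -
    have "\<bar>x - a\<bar>\<^sup>2 \<le> r\<^sup>2" using that by (intro power_mono) auto
    then have "C * \<bar>x - a\<bar>\<^sup>2 \<le> C * r\<^sup>2" using C(1) by (intro mult_left_mono) auto
    then have "C * \<bar>x - a\<bar>\<^sup>2 * \<bar>x - a\<bar> \<le> 1 / 2 * \<bar>x - a\<bar>"
      using Cr by (intro mult_right_mono) auto
    moreover have "\<bar>newton_map h x - a\<bar> \<le> C * \<bar>x - a\<bar> ^ 3"
      using that r(2) by (intro C(4)) (auto simp: dist_real_def)
    ultimately show ?thesis by (simp add: power2_eq_square power3_eq_cube mult.assoc)
  qed
  have "let x = (\<lambda>k. (newton_map h ^^ k) x0) in
      (\<forall>k. x k \<in> newton_domain V h) \<and> x \<longlonglongrightarrow> a \<and>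
      (\<forall>k. \<bar>x (Suc k) - a\<bar> \<le> C * \<bar>x k - a\<bar> ^ 3)" if x0: "\<bar>x0 - a\<bar> < r" for x0
  proof -
    define x where "x = (\<lambda>k. (newton_map h ^^ k) x0)"
    have bound: "\<bar>x k - a\<bar> \<le> (1 / 2) ^ k * \<bar>x0 - a\<bar> \<and> \<bar>x k - a\<bar> < r" for k
    proof (induction k)
      case (Suc k)
      have "\<bar>x (Suc k) - a\<bar> \<le> \<bar>x k - a\<bar> / 2" using half Suc by (simp add: x_def)
      moreover have "\<bar>x k - a\<bar> / 2 \<le> \<bar>x k - a\<bar>" by simp
      ultimately show ?case using Suc by (simp, linarith)
    qed (use x0 in \<open>auto simp: x_def\<close>)
    then have in_ball: "x k \<in> ball a r0" for k
      using r(2) by (auto simp: dist_real_def abs_minus_commute intro: less_le_trans)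
    then have "\<forall>k. x k \<in> newton_domain V h" using C(3) by blast
    moreover have "\<bar>x (Suc k) - a\<bar> \<le> C * \<bar>x k - a\<bar> ^ 3" for k
      using C(4)[OF in_ball[of k]] by (simp add: x_def)
    moreover have "(\<lambda>k. (1 / 2) ^ k * \<bar>x0 - a\<bar>) \<longlonglongrightarrow> 0"
      by (intro tendsto_mult_left_zero LIMSEQ_power_zero) simp
    then have "(\<lambda>k. x k - a) \<longlonglongrightarrow> 0"
      by (rule Lim_null_comparison[rotated]) (use bound in auto)
    then have "x \<longlonglongrightarrow> a" by (simp add: LIM_zero_iff)
    ultimately show ?thesis by (simp add: x_def Let_def)
  qed
  then show ?thesis unfolding newton_order_at_least_three_def
    using C(1) r(1) by blast
qed

end

section \<open>The transformed functions\<close>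

lemma g_eq_0_iff:
  assumes "u f x > 0"
  shows "g f p x = 0 \<longleftrightarrow> f x = 0"
proof -
  have "u f x powr p = 1 \<longleftrightarrow> p = 0 \<or> u f x = 1"
    using assms by (simp add: powr_def)
  then show ?thesis
    using assms by (simp add: g_def) (auto simp: u_def)
qed

lemma g_one: "u f x > 0 \<Longrightarrow> g f 1 x = f x"
  by (simp add: g_def u_def)

text \<open>The limit is the derivative of \<open>u\<^sup>p\<close> with respect to the exponent at \<open>p = 0\<close>.\<close>

lemma g_tendsto_ln:
  assumes "u f x > 0"
  shows "((\<lambda>p. g f p x) \<longlongrightarrow> ln (u f x)) (at 0)"
proof -
  have "((\<lambda>p. u f x powr p) has_real_derivative ln (u f x)) (at 0)"
    using assms by (auto intro!: derivative_eq_intros)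
  then have "((\<lambda>p. (u f x powr p - 1) / p) \<longlongrightarrow> ln (u f x)) (at 0)"
    using assms by (simp add: has_field_derivative_iff)
  then show ?thesis
    by (rule Lim_transform_eventually) (simp add: g_def eventually_at_filter)
qed

lemma u_powr_has_derivative:
  assumes "u f x > 0" "(f has_real_derivative D) (at x)"
  shows "((\<lambda>x. u f x powr q) has_real_derivative q * u f x powr (q - 1) * D) (at x)"
proof -
  have "(u f has_real_derivative D) (at x)"
    unfolding u_def[abs_def] using assms(2) by (auto intro!: derivative_eq_intros)
  from DERIV_fun_powr[OF this assms(1)] show ?thesis by simp
qed

lemma g_has_derivative:
  assumes "u f x > 0" "(f has_real_derivative D) (at x)"
  shows "(g f p has_real_derivative u f x powr (p - 1) * D) (at x)"
proof -
  have u: "(u f has_real_derivative D) (at x)"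
    unfolding u_def[abs_def] using assms(2) by (auto intro!: derivative_eq_intros)
  show ?thesis
  proof (cases "p = 0")
    case True
    then have "g f p = (\<lambda>x. ln (u f x))" by (auto simp: g_def)
    moreover have "((\<lambda>x. ln (u f x)) has_real_derivative u f x powr (p - 1) * D) (at x)"
      using assms(1) True
      by (auto intro!: derivative_eq_intros u simp: powr_minus field_simps)
    ultimately show ?thesis by simp
  next
    case False
    then have "g f p = (\<lambda>x. (u f x powr p - 1) / p)" by (auto simp: g_def)
    moreover have "((\<lambda>x. (u f x powr p - 1) / p) has_real_derivative u f x powr (p - 1) * D) (at x)"
      by (rule DERIV_cong[OF DERIV_cdivide[OF DERIV_diff[OF u_powr_has_derivative[OF assms]
            DERIV_const]]])
        (use False in simp)
    ultimately show ?thesis by simp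
  qed
qed

lemma simple_zero_g:
  assumes "open U" "\<alpha> \<in> U" "Ck_on 3 f U" "f \<alpha> = 0" "deriv f \<alpha> \<noteq> 0"
  shows "simple_zero {x \<in> U. u f x > 0} (g f p) (\<lambda>x. u f x powr (p - 1) * deriv f x)
    (\<lambda>x. (p - 1) * u f x powr (p - 2) * (deriv f x)\<^sup>2 + u f x powr (p - 1) * (deriv ^^ 2) f x) \<alpha>"
proof -
  have Ck: "Ck_on (Suc (Suc (Suc 0))) f U" using assms(3) by (simp add: numeral_3_eq_3)
  have f1: "(f has_real_derivative deriv f x) (at x)"
    and f2: "(deriv f has_real_derivative (deriv ^^ 2) f x) (at x)"
    and f3: "((deriv ^^ 2) f has_real_derivative deriv ((deriv ^^ 2) f) x) (at x)"
    if "x \<in> U" for x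
    using Ck that
    by (auto simp: numeral_2_eq_2 DERIV_deriv_iff_real_differentiable)
  have "continuous_on U f"
    using f1 by (meson DERIV_continuous continuous_at_imp_continuous_on)
  then have "open (U \<inter> f -` {-1<..})"
    using assms(1) by (intro continuous_open_preimage) auto
  also have "U \<inter> f -` {-1<..} = {x \<in> U. u f x > 0}" by (auto simp: u_def)
  finally have open_V: "open {x \<in> U. u f x > 0}" .
  have u\<alpha>: "u f \<alpha> = 1" by (simp add: u_def assms(4))
  have h2: "((\<lambda>x. u f x powr (p - 1) * deriv f x) has_real_derivative
      (p - 1) * u f x powr (p - 2) * (deriv f x)\<^sup>2 + u f x powr (p - 1) * (deriv ^^ 2) f x) (at x)"
    if "x \<in> U" "u f x > 0" for x
    by (rule DERIV_cong[OF DERIV_mult[OF u_powr_has_derivative[OF that(2) f1] f2]])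
       (use that in \<open>auto simp: power2_eq_square algebra_simps\<close>)
  have u\<alpha>': "u f \<alpha> > 0" by (simp add: u\<alpha>)
  note d = u_powr_has_derivative[OF u\<alpha>' f1[OF assms(2)]] f2[OF assms(2)] f3[OF assms(2)]
  note DERIV_add[OF DERIV_mult[OF DERIV_cmult[OF d(1), of "p - 1" "p - 2"]
        DERIV_power[OF d(2), of 2]] DERIV_mult[OF d(1)[of "p - 1"] d(3)]]
  then have "(\<lambda>x. (p - 1) * u f x powr (p - 2) * (deriv f x)\<^sup>2
      + u f x powr (p - 1) * (deriv ^^ 2) f x) differentiable (at \<alpha>)"
    unfolding real_differentiable_def by blast
  with open_V h2 show ?thesis
    using assms f1 u\<alpha> by unfold_locales (auto intro: g_has_derivative simp: g_eq_0_iff)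
qed

theorem mainTheorem3:
  fixes f :: "real \<Rightarrow> real" and \<alpha> :: real and U :: "real set"
  assumes "open U" and "\<alpha> \<in> U" and "Ck_on 3 f U"
    and "f \<alpha> = 0" and "deriv f \<alpha> \<noteq> 0"
  shows "(\<forall>p. \<forall>x\<in>U. u f x > 0 \<longrightarrow> (g f p x = 0 \<longleftrightarrow> f x = 0)) \<and>
    (\<forall>x\<in>U. u f x > 0 \<longrightarrow> g f 1 x = f x) \<and>
    (\<forall>x\<in>U. u f x > 0 \<longrightarrow> ((\<lambda>p. g f p x) \<longlongrightarrow> ln (u f x)) (at 0)) \<and>
    (\<forall>p. twice_differentiable_at (g f p) \<alpha> \<and>
         deriv (g f p) \<alpha> = deriv f \<alpha> \<and>
         (deriv ^^ 2) (g f p) \<alpha> = (p - 1) * (deriv f \<alpha>)\<^sup>2 + (deriv ^^ 2) f \<alpha> \<and>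
         twice_differentiable_at (newton_map (g f p)) \<alpha> \<and>
         (deriv ^^ 2) (newton_map (g f p)) \<alpha> = (deriv ^^ 2) (g f p) \<alpha> / deriv (g f p) \<alpha>) \<and>
    (deriv ^^ 2) (newton_map (g f (p_star f \<alpha>))) \<alpha> = 0 \<and>
    newton_order_at_least_three {x \<in> U. u f x > 0} (g f (p_star f \<alpha>)) \<alpha>"
proof -
  let ?V = "{x \<in> U. u f x > 0}"
  define h1 where "h1 = (\<lambda>p x. u f x powr (p - 1) * deriv f x)"
  define h2 where "h2 = (\<lambda>p x. (p - 1) * u f x powr (p - 2) * (deriv f x)\<^sup>2
    + u f x powr (p - 1) * (deriv ^^ 2) f x)"
  have sz: "simple_zero ?V (g f p) (h1 p) (h2 p) \<alpha>" for p
    using simple_zero_g[OF assms] unfolding h1_def h2_def .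
  have val: "h1 p \<alpha> = deriv f \<alpha>" "h2 p \<alpha> = (p - 1) * (deriv f \<alpha>)\<^sup>2 + (deriv ^^ 2) f \<alpha>" for p
    using assms(4) by (auto simp: h1_def h2_def u_def)
  have d1: "deriv (g f p) \<alpha> = deriv f \<alpha>" for p
    using simple_zero.h1[OF sz simple_zero.a_in_V[OF sz]] val(1) DERIV_imp_deriv by metis
  have d2: "twice_differentiable_at (g f p) \<alpha>"
    "(deriv ^^ 2) (g f p) \<alpha> = (p - 1) * (deriv f \<alpha>)\<^sup>2 + (deriv ^^ 2) f \<alpha>" for p
    using twice_differentiable_atI[OF simple_zero.open_V[OF sz] simple_zero.a_in_V[OF sz]
        simple_zero.h1[OF sz] simple_zero.h2[OF sz simple_zero.a_in_V[OF sz]]]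
    by (auto simp: val)
  have N: "twice_differentiable_at (newton_map (g f p)) \<alpha>"
    "(deriv ^^ 2) (newton_map (g f p)) \<alpha> = (deriv ^^ 2) (g f p) \<alpha> / deriv (g f p) \<alpha>" for p
    using simple_zero.newton_map_second_deriv[OF sz] by (auto simp: d1 d2 val)
  have star: "h2 (p_star f \<alpha>) \<alpha> = 0"
    using assms(5) by (simp add: val p_star_def)
  have "(deriv ^^ 2) (newton_map (g f (p_star f \<alpha>))) \<alpha> = 0"
    using simple_zero.newton_map_second_deriv(2)[OF sz] star by simp
  moreover have "newton_order_at_least_three ?V (g f (p_star f \<alpha>)) \<alpha>"
    using simple_zero.newton_order_three[OF sz star] .
  ultimately show ?thesis
    by (intro conjI allI ballI impI g_eq_0_iff g_one g_tendsto_ln d1 d2 N)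
qed

end
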